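(* Let $\mathcal{G}=(G,\theta)$ be a valued digraph. Then the poset $(IS(\mathcal{G}),\subseteq)$ is a graded complete meet semi-lattice, with rank function $\rho:A\mapsto |A|$. Moreover, if $G$ is finite, then $(IS(\mathcal{G}),\subseteq)$ is a complete lattice.
   Context: A simple digraph is a pair $G=(V,E)$ with $E\subseteq V\times V$; it is acyclic if there is no finite sequence $x_1,\dots,x_m$ of vertices with $(x_i,x_{i+1})\in E$ for all $i$ (indices mod $m$). The out-degree of $x$ is $d^+(x)=|\{y:(x,y)\in E\}|$ (possibly infinite). A valued digraph is a pair $\mathcal{G}=(G,\theta)$ where $G$ is a simple acyclic digraph and $\theta:V\to\mathbb{N}$ satisfies $0\le\theta(x)\le d^+(x)$ for all $x$. A vertex $x$ is erasable in $\mathcal{G}$ if $\theta(x)=0$ and every $z$ with $(z,x)\in E$ has $\theta(z)\neq0$. Peeling process: set $\mathcal{G}_1=\mathcal{G}$; if $\mathcal{G}_i=(G_i,\theta_i)$ has no erasable vertex, stop; otherwise choose an erasable vertex $x_i$ of $\mathcal{G}_i$, let $G_{i+1}$ be $G_i$ with $x_i$ and all arcs incident to it removed, and let $\theta_{i+1}(y)=\theta_i(y)-1$ if $(y,x_i)$ is an arc of $G_i$ and $\theta_{i+1}(y)=\theta_i(y)$ otherwise; iterate. Any resulting sequence $[x_1,x_2,\dots]$ (finite or infinite) is a peeling sequence of $\mathcal{G}$. An initial section of a peeling sequence $[x_1,x_2,\dots]$ is a set $\{x_1,\dots,x_k\}$ with $k\ge1$, or $\emptyset$. $IS(\mathcal{G})$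 denotes the set of all initial sections of all peeling sequences of $\mathcal{G}$. A poset is a complete meet semi-lattice if every subset has an infimum; a complete lattice if every subset has both an infimum and a supremum.
   Formalization: In "complete meet semi-lattice" infima are required only for nonempty subsets: with V infinite, no arcs and θ = 0, the initial sections are all finite subsets of V, which have no greatest element, so the empty subset has no infimum. *)

theory Defs
  imports
    "Graph_Theory.Pair_Digraph"
    "HOL-Algebra.Complete_Lattice"
    "HOL-Library.Extended_Nat"
begin

section \<open>Valued digraphs\<close>

text \<open>
  Vertex sets may be infinite, so the out-degree is an extended natural number
  (the library's \<open>out_degree\<close> is a \<open>card\<close>, hence \<open>0\<close> for infinitely many out-arcs).
\<close>

definition eout_degree :: "'a pair_pre_digraph \<Rightarrow> 'a \<Rightarrow> enat" where
  "eout_degree G x =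
    (let N = {y. (x, y) \<in> parcs G} in if finite N then enat (card N) else \<infinity>)"

text \<open>
  \<open>acyclic\<close> is irreflexivity of the transitive closure, so it also excludes loops.
  Only the values of \<open>\<theta>\<close> on \<open>pverts G\<close> matter, here and below.
\<close>

locale valued_digraph = pair_wf_digraph G
  for G :: "'a pair_pre_digraph" +
  fixes \<theta> :: "'a \<Rightarrow> nat"
  assumes acyclic: "acyclic (parcs G)"
    and theta_le_degree: "x \<in> pverts G \<Longrightarrow> enat (\<theta> x) \<le> eout_degree G x"


section \<open>The peeling process\<close>

type_synonym 'a valued = "'a pair_pre_digraph \<times> ('a \<Rightarrow> nat)"

fun erasable :: "'a valued \<Rightarrow> 'a \<Rightarrow> bool" where
  "erasable (G, \<theta>) x \<longleftrightarrow>
    x \<in> pverts G \<and> \<theta> x = 0 \<and> (\<forall>z. (z, x) \<in> parcs G \<longrightarrow> \<theta> z \<noteq> 0)"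

text \<open>
  The subtraction below is never truncated when \<open>x\<close> is erasable.
\<close>

fun peel :: "'a \<Rightarrow> 'a valued \<Rightarrow> 'a valued" where
  "peel x (G, \<theta>) =
    (\<lparr> pverts = pverts G - {x},
       parcs = {(y, z) \<in> parcs G. y \<noteq> x \<and> z \<noteq> x} \<rparr>,
     \<lambda>y. if (y, x) \<in> parcs G then \<theta> y - 1 else \<theta> y)"

primrec stage :: "'a valued \<Rightarrow> (nat \<Rightarrow> 'a) \<Rightarrow> nat \<Rightarrow> 'a valued" where
  "stage \<G> x 0 = \<G>"
| "stage \<G> x (Suc i) = peel (x i) (stage \<G> x i)"

text \<open>
  A finite or infinite sequence is a function \<open>x\<close> together with a length \<open>n\<close>, its
  entries being the \<open>x i\<close> with \<open>enat i < n\<close>; the indices start at \<open>0\<close>. A finite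
  sequence is a peeling sequence only if the process stops after it.
\<close>

definition peeling_sequence :: "'a valued \<Rightarrow> enat \<Rightarrow> (nat \<Rightarrow> 'a) \<Rightarrow> bool" where
  "peeling_sequence \<G> n x \<longleftrightarrow>
    (\<forall>i. enat i < n \<longrightarrow> erasable (stage \<G> x i) (x i)) \<and>
    (\<forall>m. n = enat m \<longrightarrow> (\<nexists>y. erasable (stage \<G> x m) y))"

text \<open>The case \<open>k = 0\<close> gives the empty initial section.\<close>

definition IS :: "'a valued \<Rightarrow> 'a set set" where
  "IS \<G> = {x ` {..<k} | n x k. peeling_sequence \<G> n x \<and> enat k \<le> n}"

definition IS_poset :: "'a valued \<Rightarrow> 'a set gorder" where
  "IS_poset \<G> = \<lparr> carrier = IS \<G>, eq = (=), le = (\<subseteq>) \<rparr>"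


section \<open>Graded posets and complete meet semi-lattices\<close>

text \<open>
  Infima are required of nonempty subsets only: an infimum of the empty subset is a
  greatest element, which a complete meet semi-lattice need not have. In contrast,
  \<open>complete_lattice\<close> requires infima and suprema of all subsets.
\<close>

locale complete_meet_semilattice = partial_order +
  assumes inf_exists:
    "\<lbrakk>A \<subseteq> carrier L; A \<noteq> {}\<rbrakk> \<Longrightarrow> \<exists>i. greatest L i (Lower L A)"

definition covered_by :: "('a, 'b) gorder_scheme \<Rightarrow> 'a \<Rightarrow> 'a \<Rightarrow> bool" where
  "covered_by L x y \<longleftrightarrow>
    x \<in> carrier L \<and> y \<in> carrier L \<and> x \<sqsubset>\<^bsub>L\<^esub> y \<and>
    (\<nexists>z. z \<in> carrier L \<and> x \<sqsubset>\<^bsub>L\<^esub> z \<and> z \<sqsubset>\<^bsub>L\<^esub> y)"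

locale graded_poset = partial_order L
  for L :: "('a, 'b) gorder_scheme" (structure) +
  fixes \<rho> :: "'a \<Rightarrow> nat"
  assumes rank_minimal:
      "\<lbrakk>x \<in> carrier L; \<nexists>y. y \<in> carrier L \<and> y \<sqsubset> x\<rbrakk> \<Longrightarrow> \<rho> x = 0"
    and rank_strict_mono:
      "\<lbrakk>x \<in> carrier L; y \<in> carrier L; x \<sqsubset> y\<rbrakk> \<Longrightarrow> \<rho> x < \<rho> y"
    and rank_covered_by:
      "covered_by L x y \<Longrightarrow> \<rho> y = Suc (\<rho> x)"

end

theory Submission
  imports Defs
begin

text \<open>
  Write \<open>d A z\<close> for the number of out-neighbours of \<open>z\<close> in \<open>A\<close>. The stage reached after
  peeling \<open>A\<close> depends only on \<open>A\<close>: a remaining vertex \<open>z\<close> then has value \<open>\<theta> z - d A z\<close>.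
  The initial sections turn out to be exactly the finite sets \<open>A\<close> with \<open>\<theta> z \<le> d A z\<close> for
  \<open>z \<in> A\<close> and \<open>d A z \<le> \<theta> z\<close> for \<open>z \<notin> A\<close>. Given such sets \<open>A \<subset> B\<close>, a sink of \<open>B - A\<close> has
  value \<open>0\<close> after peeling \<open>A\<close>, and an element of \<open>B - A\<close> that is topmost among those of
  value \<open>0\<close> is erasable; this yields both the characterization and the rank function.

  The second condition is stable under intersections and the first one under unions. A set
  satisfying the first condition inside a finite set satisfying the second one extends, within
  the latter, to an initial section: take a minimal set in between satisfying the second
  condition. Hence the union of all lower bounds of a nonempty family is itself a lower bound.
\<close>

text \<open>Restricted to a finite set, an acyclic relation is well-founded. Applied to arcs it
  yields a topmost vertex, applied to reversed arcs a sink.\<close>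

lemma acyclic_finite_minimal:
  assumes "acyclic r" "finite S" "S \<noteq> {}"
  obtains m where "m \<in> S" "\<And>y. y \<in> S \<Longrightarrow> (y, m) \<notin> r"
proof -
  have "wf (r \<inter> S \<times> S)"
    using assms by (intro finite_acyclic_wf) (auto intro: acyclic_subset)
  then obtain m where "m \<in> S" "\<And>y. (y, m) \<in> r \<inter> S \<times> S \<Longrightarrow> y \<notin> S"
    using assms(3) by (metis all_not_in_conv wfE_min)
  then show thesis
    using that[of m] by blast
qed

context valued_digraph
begin

section \<open>Arc counts and feasible sets\<close>

definition arcs_into :: "'a set \<Rightarrow> 'a \<Rightarrow> nat" where
  "arcs_into A z = card {y \<in> A. (z, y) \<in> parcs G}"

definition inner_bound :: "'a set \<Rightarrow> bool" where
  "inner_bound A \<longleftrightarrow> (\<forall>z\<in>A. \<theta> z \<le> arcs_into A z)"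

definition outer_bound :: "'a set \<Rightarrow> bool" where
  "outer_bound A \<longleftrightarrow> (\<forall>z\<in>pverts G - A. arcs_into A z \<le> \<theta> z)"

definition feasible :: "'a set \<Rightarrow> bool" where
  "feasible A \<longleftrightarrow> finite A \<and> A \<subseteq> pverts G \<and> inner_bound A \<and> outer_bound A"

text \<open>Finiteness of \<open>B\<close> matters: \<open>card\<close> is 0 on infinite sets, so a
  larger set could have the smaller count.\<close>

lemma arcs_into_mono: "finite B \<Longrightarrow> A \<subseteq> B \<Longrightarrow> arcs_into A z \<le> arcs_into B z"
  unfolding arcs_into_def by (intro card_mono) auto

lemma arcs_into_insert:
  assumes "finite A" "x \<notin> A"
  shows "arcs_into (insert x A) z = arcs_into A z + (if (z, x) \<in> parcs G then 1 else 0)"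
proof -
  have "{y \<in> insert x A. (z, y) \<in> parcs G} =
      (if (z, x) \<in> parcs G then insert x {y \<in> A. (z, y) \<in> parcs G} else {y \<in> A. (z, y) \<in> parcs G})"
    by auto
  then show ?thesis
    using assms by (simp add: arcs_into_def)
qed

lemma arcs_into_empty [simp]: "arcs_into {} z = 0"
  by (simp add: arcs_into_def)

lemma feasible_empty: "feasible {}"
  by (simp add: feasible_def inner_bound_def outer_bound_def)

lemma inner_bound_Union:
  assumes "finite (\<Union>\<C>)" "\<And>A. A \<in> \<C> \<Longrightarrow> inner_bound A"
  shows "inner_bound (\<Union>\<C>)"
  unfolding inner_bound_def
proof
  fix z assume "z \<in> \<Union>\<C>"
  then obtain A where A: "A \<in> \<C>" "z \<in> A" by blast
  have "\<theta> z \<le> arcs_into A z"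
    using assms(2) A by (auto simp: inner_bound_def)
  also have "\<dots> \<le> arcs_into (\<Union>\<C>) z"
    using assms(1) A by (intro arcs_into_mono) auto
  finally show "\<theta> z \<le> arcs_into (\<Union>\<C>) z" .
qed

lemma outer_bound_Inter:
  assumes "\<And>A. A \<in> \<C> \<Longrightarrow> outer_bound A \<and> finite A"
  shows "outer_bound (\<Inter>\<C>)"
  unfolding outer_bound_def
proof
  fix z assume "z \<in> pverts G - \<Inter>\<C>"
  then obtain A where A: "A \<in> \<C>" "z \<in> pverts G - A" by blast
  have "arcs_into (\<Inter>\<C>) z \<le> arcs_into A z"
    using assms A by (intro arcs_into_mono) auto
  also have "\<dots> \<le> \<theta> z"
    using assms A by (auto simp: outer_bound_def)
  finally show "arcs_into (\<Inter>\<C>) z \<le> \<theta> z" .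
qed

lemma feasible_between:
  assumes "inner_bound U" "U \<subseteq> W" "finite W" "W \<subseteq> pverts G" "outer_bound W"
  obtains E where "feasible E" "U \<subseteq> E" "E \<subseteq> W"
proof -
  define \<Y> where "\<Y> = {Y. U \<subseteq> Y \<and> Y \<subseteq> W \<and> outer_bound Y}"
  have "finite \<Y>"
    by (rule finite_subset[of _ "Pow W"]) (use assms(3) in \<open>auto simp: \<Y>_def\<close>)
  moreover have "\<Y> \<noteq> {}"
    using assms by (auto simp: \<Y>_def)
  ultimately obtain E where "E \<in> \<Y>" and "\<forall>Y\<in>\<Y>. Y \<subseteq> E \<longrightarrow> E = Y"
    using finite_has_minimal[of \<Y>] by auto
  then have E: "U \<subseteq> E" "E \<subseteq> W" "outer_bound E"
    and min: "\<And>Y. U \<subseteq> Y \<Longrightarrow> Y \<subseteq> W \<Longrightarrow> outer_bound Y \<Longrightarrow> Y \<subseteq> E \<Longrightarrow> E = Y"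
    by (auto simp: \<Y>_def)
  have fin: "finite E"
    using E assms(3) by (auto intro: finite_subset)
  have "inner_bound E"
    unfolding inner_bound_def
  proof (rule ccontr)
    assume "\<not> (\<forall>z\<in>E. \<theta> z \<le> arcs_into E z)"
    then obtain z where z: "z \<in> E" "arcs_into E z < \<theta> z" by force
    have le: "arcs_into (E - {z}) w \<le> arcs_into E w" for w
      using fin by (intro arcs_into_mono) auto
    \<comment> \<open>A member of \<open>U\<close> has at least \<open>\<theta> z\<close>
      out-neighbours in \<open>U\<close>, hence in \<open>E\<close>.\<close>
    have "z \<notin> U"
      using assms(1) arcs_into_mono[OF fin, of U z] E z by (fastforce simp: inner_bound_def)
    \<comment> \<open>Removing \<open>z\<close> only lowers counts, and \<open>z\<close> itself
      satisfies the bound because it violates the inner one.\<close>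
    moreover have "outer_bound (E - {z})"
      unfolding outer_bound_def
    proof
      fix w assume "w \<in> pverts G - (E - {z})"
      then show "arcs_into (E - {z}) w \<le> \<theta> w"
        using E z le[of w] by (cases "w = z") (force simp: outer_bound_def)+
    qed
    ultimately have "E = E - {z}"
      using E by (intro min) auto
    then show False
      using z by blast
  qed
  then show thesis
    using E fin assms(4) by (intro that[of E]) (auto simp: feasible_def)
qed

section \<open>Stages of the peeling process\<close>

text \<open>Stated additively, so that no truncated subtraction occurs.\<close>

definition stage_of :: "'a set \<Rightarrow> 'a valued \<Rightarrow> bool" where
  "stage_of A \<H> \<longleftrightarrow>
    pverts (fst \<H>) = pverts G - A \<and>
    parcs (fst \<H>) = {(y, z) \<in> parcs G. y \<notin> A \<and> z \<notin> A} \<and>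
    (\<forall>y\<in>pverts G - A. \<theta> y = snd \<H> y + arcs_into A y)"

lemma stage_of_empty: "stage_of {} (G, \<theta>)"
  by (simp add: stage_of_def)

lemma stage_of_erasable_iff:
  assumes "stage_of A \<H>"
  shows "erasable \<H> x \<longleftrightarrow> x \<in> pverts G - A \<and> \<theta> x = arcs_into A x \<and>
    (\<forall>z. z \<notin> A \<longrightarrow> (z, x) \<in> parcs G \<longrightarrow> arcs_into A z < \<theta> z)"
proof (cases \<H>)
  case (Pair H \<eta>)
  have "\<theta> y = \<eta> y + arcs_into A y" if "y \<in> pverts G - A" for y
    using assms that Pair by (auto simp: stage_of_def)
  moreover have "z \<in> pverts G" if "(z, x) \<in> parcs G" for z
    using that in_arcsD1 by blast
  ultimately show ?thesis
    using assms Pair by (fastforce simp: stage_of_def)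
qed

text \<open>Erasability makes the subtraction in \<open>peel\<close> exact: a remaining in-neighbour
  of \<open>x\<close> has positive value and gains one arc into the peeled set.\<close>

lemma stage_of_peel:
  assumes "stage_of A \<H>" "finite A" "erasable \<H> x"
  shows "stage_of (insert x A) (peel x \<H>)"
proof (cases \<H>)
  case (Pair H \<eta>)
  have x: "x \<notin> A" and pos: "\<And>z. z \<notin> A \<Longrightarrow> (z, x) \<in> parcs G \<Longrightarrow> arcs_into A z < \<theta> z"
    using assms(1,3) stage_of_erasable_iff by auto
  have "\<theta> y = snd (peel x \<H>) y + arcs_into (insert x A) y" if "y \<in> pverts G - insert x A" for y
  proof -
    have "\<theta> y = \<eta> y + arcs_into A y"
      using assms(1) that Pair by (auto simp: stage_of_def)
    moreover have "(y, x) \<in> parcs H \<longleftrightarrow> (y, x) \<in> parcs G"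
      using assms(1) that Pair x by (auto simp: stage_of_def)
    ultimately show ?thesis
      using pos[of y] that Pair x assms(2) by (auto simp: arcs_into_insert)
  qed
  then show ?thesis
    using assms(1) Pair by (auto simp: stage_of_def)
qed

text \<open>The vertex \<open>x\<close> meets the inner bound with equality, and the strict
  inequality at its remaining in-neighbours leaves room for one more arc.\<close>

lemma feasible_peel:
  assumes "stage_of A \<H>" "feasible A" "erasable \<H> x"
  shows "feasible (insert x A)"
proof -
  have fin: "finite A" and x: "x \<in> pverts G - A" "\<theta> x = arcs_into A x"
    and pos: "\<And>z. z \<notin> A \<Longrightarrow> (z, x) \<in> parcs G \<Longrightarrow> arcs_into A z < \<theta> z"
    using assms stage_of_erasable_iff by (auto simp: feasible_def)
  have "\<theta> z \<le> arcs_into (insert x A) z" if "z \<in> insert x A" for z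
    using that assms(2) x fin
    by (auto simp: arcs_into_insert feasible_def inner_bound_def intro: trans_le_add1)
  moreover have "arcs_into (insert x A) z \<le> \<theta> z" if "z \<in> pverts G - insert x A" for z
    using that assms(2) x fin pos[of z]
    by (auto simp: arcs_into_insert feasible_def outer_bound_def)
  ultimately show ?thesis
    using assms(2) x by (auto simp: feasible_def inner_bound_def outer_bound_def)
qed

lemma ex_erasable_between:
  assumes "stage_of A \<H>" "feasible A" "feasible B" "A \<subset> B"
  obtains x where "x \<in> B - A" "erasable \<H> x"
proof -
  have fin: "finite A" "finite B" and B: "B \<subseteq> pverts G"
    using assms by (auto simp: feasible_def)
  obtain s where s: "s \<in> B - A" "\<And>y. y \<in> B - A \<Longrightarrow> (y, s) \<notin> (parcs G)\<inverse>"
    using acyclic_finite_minimal[of "(parcs G)\<inverse>" "B - A"] acyclic fin assms(4)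
    by (auto simp: acyclic_converse)
  define Z where "Z = {z \<in> B - A. \<theta> z = arcs_into A z}"
  \<comment> \<open>As a sink of \<open>B - A\<close>, \<open>s\<close> has all its out-neighbours
    in \<open>B\<close> already in \<open>A\<close>; the two bounds then force its current value to
    be 0.\<close>
  have "{y \<in> B. (s, y) \<in> parcs G} = {y \<in> A. (s, y) \<in> parcs G}"
    using s assms(4) by auto
  then have "arcs_into B s = arcs_into A s"
    by (simp add: arcs_into_def)
  moreover have "\<theta> s \<le> arcs_into B s" "arcs_into A s \<le> \<theta> s"
    using s assms(2,3) by (auto simp: feasible_def inner_bound_def outer_bound_def)
  ultimately have "s \<in> Z"
    using s by (simp add: Z_def)
  moreover have "finite Z"
    using fin by (simp add: Z_def)
  ultimately obtain x where x: "x \<in> Z" "\<And>z. z \<in> Z \<Longrightarrow> (z, x) \<notin> parcs G"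
    using acyclic_finite_minimal[OF acyclic, of Z] by blast
  have "arcs_into A z < \<theta> z" if z: "z \<notin> A" "(z, x) \<in> parcs G" for z
  proof -
    have zV: "z \<in> pverts G"
      using z in_arcsD1 by blast
    have le: "arcs_into A z \<le> \<theta> z"
      using assms(2) z zV by (auto simp: feasible_def outer_bound_def)
    show ?thesis
    proof (cases "z \<in> B")
      \<comment> \<open>Equality would put \<open>z\<close> into \<open>Z\<close>, above the topmost
        \<open>x\<close>.\<close>
      case True
      then show ?thesis
        using x(2)[of z] z le by (auto simp: Z_def order.order_iff_strict)
    next
      \<comment> \<open>The outer bound of \<open>B\<close> holds at \<open>z\<close> and also
        counts the arc to \<open>x\<close>, which \<open>A\<close> misses.\<close>
      case False
      have "arcs_into A z < arcs_into (insert x A) z"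
        using z x fin by (simp add: arcs_into_insert Z_def)
      also have "\<dots> \<le> arcs_into B z"
        using x assms(4) fin by (intro arcs_into_mono) (auto simp: Z_def)
      also have "\<dots> \<le> \<theta> z"
        using False zV assms(3) by (auto simp: feasible_def outer_bound_def)
      finally show ?thesis .
    qed
  qed
  then show thesis
    using that[of x] x B stage_of_erasable_iff[OF assms(1)] by (auto simp: Z_def)
qed

text \<open>Only the erasability of the first \<open>k\<close> entries is assumed, so this applies
  while a peeling sequence is still being built. The cardinality records that entries never
  repeat.\<close>

lemma stage_prefix:
  assumes "\<And>i. i < k \<Longrightarrow> erasable (stage (G, \<theta>) x i) (x i)"
  shows "feasible (x ` {..<k}) \<and> stage_of (x ` {..<k}) (stage (G, \<theta>) x k) \<and> card (x ` {..<k}) = k"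
  using assms
proof (induction k)
  case 0
  then show ?case by (simp add: feasible_empty stage_of_empty)
next
  case (Suc k)
  let ?A = "x ` {..<k}"
  have IH: "feasible ?A" "stage_of ?A (stage (G, \<theta>) x k)" "card ?A = k"
    and er: "erasable (stage (G, \<theta>) x k) (x k)"
    using Suc by auto
  have "x k \<notin> ?A"
    using er stage_of_erasable_iff[OF IH(2)] by blast
  moreover have "x ` {..<Suc k} = insert (x k) ?A"
    by (simp add: lessThan_Suc)
  ultimately show ?case
    using IH er feasible_peel stage_of_peel by (simp add: card_insert_if)
qed

section \<open>Initial sections as feasible sets\<close>

text \<open>
  The peeling sequence is built greedily, preferring erasable vertices of \<open>A\<close> as long as
  there are any.
\<close>

lemma feasible_in_IS:
  assumes A: "feasible A"
  shows "A \<in> IS (G, \<theta>)"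
proof -
  define pick where "pick \<H> = (SOME y. erasable \<H> y \<and> ((\<exists>a\<in>A. erasable \<H> a) \<longrightarrow> y \<in> A))"
    for \<H> :: "'a valued"
  \<comment> \<open>Each choice depends on the current stage, so the stages are iterated first and
    the sequence \<open>x\<close> is read off; \<open>st\<close> identifies them with
    \<open>stage\<close>.\<close>
  define s where "s i = ((\<lambda>\<H>. peel (pick \<H>) \<H>) ^^ i) (G, \<theta>)" for i
  define x where "x i = pick (s i)" for i
  have st: "stage (G, \<theta>) x i = s i" for i
    by (induction i) (simp_all add: s_def x_def)
  have pick: "erasable (s i) (x i) \<and> ((\<exists>a\<in>A. erasable (s i) a) \<longrightarrow> x i \<in> A)"
    if "\<exists>y. erasable (s i) y" for i
    unfolding x_def pick_def by (rule someI_ex) (use that in blast)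
  have prefix: "x ` {..<k} \<subseteq> A \<and> (\<forall>i<k. erasable (s i) (x i))" if "k \<le> card A" for k
    using that
  proof (induction k)
    case 0
    then show ?case by simp
  next
    case (Suc k)
    then have IH: "x ` {..<k} \<subseteq> A" "\<forall>i<k. erasable (s i) (x i)" by auto
    then have *: "feasible (x ` {..<k})" "stage_of (x ` {..<k}) (s k)" "card (x ` {..<k}) = k"
      using stage_prefix[of k x] by (auto simp: st)
    then have "x ` {..<k} \<subset> A"
      using IH(1) Suc.prems by auto
    then obtain a where "a \<in> A - x ` {..<k}" "erasable (s k) a"
      by (rule ex_erasable_between[OF *(2,1) A])
    then have "erasable (s k) (x k)" "x k \<in> A"
      using pick[of k] by blast+
    then show ?case
      using IH by (auto simp: lessThan_Suc less_Suc_eq)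
  qed
  have "x ` {..<card A} = A"
  proof (rule card_subset_eq)
    show "finite A"
      using A by (simp add: feasible_def)
    show "x ` {..<card A} \<subseteq> A" "card (x ` {..<card A}) = card A"
      using prefix[of "card A"] stage_prefix[of "card A" x] by (auto simp: st)
  qed
  \<comment> \<open>The length is infinite if the process never stops, and otherwise the index
    \<open>m\<close> of the first stage without erasable vertex. The first \<open>card A\<close>
    stages all have one, so \<open>card A \<le> m\<close>.\<close>
  moreover have "\<exists>n. peeling_sequence (G, \<theta>) n x \<and> enat (card A) \<le> n"
  proof (cases "\<forall>i. \<exists>y. erasable (s i) y")
    case True
    then have "peeling_sequence (G, \<theta>) \<infinity> x"
      using pick by (auto simp: peeling_sequence_def st)
    then show ?thesis by fastforce
  next
    case False
    define m where "m = (LEAST i. \<nexists>y. erasable (s i) y)"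
    have m: "\<nexists>y. erasable (s m) y"
      unfolding m_def by (rule LeastI_ex) (use False in blast)
    have "\<exists>y. erasable (s i) y" if "i < m" for i
      using that not_less_Least unfolding m_def by blast
    then have "peeling_sequence (G, \<theta>) (enat m) x"
      using m pick by (auto simp: peeling_sequence_def st)
    moreover have "card A \<le> m"
      using prefix[of "card A"] m by (meson le_refl not_le)
    ultimately show ?thesis by fastforce
  qed
  ultimately show ?thesis
    unfolding IS_def by (smt (verit) mem_Collect_eq)
qed

lemma IS_iff_feasible: "A \<in> IS (G, \<theta>) \<longleftrightarrow> feasible A"
proof
  assume "A \<in> IS (G, \<theta>)"
  then obtain n x k where "A = x ` {..<k}" "peeling_sequence (G, \<theta>) n x" "enat k \<le> n"
    by (auto simp: IS_def)
  moreover from this have "erasable (stage (G, \<theta>) x i) (x i)" if "i < k" for i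
    using that unfolding peeling_sequence_def by (meson enat_ord_simps(2) less_le_trans)
  ultimately show "feasible A"
    using stage_prefix by blast
qed (rule feasible_in_IS)

text \<open>Being an initial section, \<open>A\<close> is realised by an actual stage, in which a
  vertex of \<open>B - A\<close> can be peeled.\<close>

lemma feasible_extend:
  assumes "feasible A" "feasible B" "A \<subset> B"
  obtains x where "x \<in> B - A" "feasible (insert x A)"
proof -
  obtain n x k where x: "A = x ` {..<k}" "peeling_sequence (G, \<theta>) n x" "enat k \<le> n"
    using feasible_in_IS[OF assms(1)] by (auto simp: IS_def)
  then have "stage_of A (stage (G, \<theta>) x k)"
    using stage_prefix[of k x] unfolding peeling_sequence_def
    by (meson enat_ord_simps(2) less_le_trans)
  then show thesis
    using ex_erasable_between feasible_peel assms that by metis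
qed

section \<open>Infima and the top element\<close>

lemma feasible_Union_lower:
  assumes "\<A> \<noteq> {}" "\<And>A. A \<in> \<A> \<Longrightarrow> feasible A"
  shows "feasible (\<Union>{C. feasible C \<and> C \<subseteq> \<Inter>\<A>})"
proof -
  let ?W = "\<Inter>\<A>" and ?U = "\<Union>{C. feasible C \<and> C \<subseteq> \<Inter>\<A>}"
  obtain A where "A \<in> \<A>"
    using assms(1) by blast
  then have W: "finite ?W" "?W \<subseteq> pverts G" "outer_bound ?W"
    using assms by (auto simp: feasible_def intro!: outer_bound_Inter intro: finite_subset[of _ A])
  have "?U \<subseteq> ?W" by blast
  moreover from this have "inner_bound ?U"
    using W(1) by (intro inner_bound_Union) (auto simp: feasible_def intro: finite_subset)
  ultimately obtain E where E: "feasible E" "?U \<subseteq> E" "E \<subseteq> ?W"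
    using feasible_between[OF _ _ W] by blast
  \<comment> \<open>\<open>E\<close> is itself one of the sets united in \<open>?U\<close>.\<close>
  then have "?U = E" by blast
  with E show ?thesis by simp
qed

text \<open>In a finite digraph the count into all vertices is the out-degree, so the inner bound is
  the degree bound on \<open>\<theta>\<close>; the outer bound is vacuous.\<close>

lemma feasible_pverts:
  assumes "finite (pverts G)"
  shows "feasible (pverts G)"
proof -
  have "\<theta> z \<le> arcs_into (pverts G) z" if "z \<in> pverts G" for z
  proof -
    have "{y. (z, y) \<in> parcs G} = {y \<in> pverts G. (z, y) \<in> parcs G}"
      using in_arcsD2 by auto
    then show ?thesis
      using theta_le_degree[OF that] assms by (simp add: eout_degree_def arcs_into_def)
  qed
  then show ?thesis
    using assms by (auto simp: feasible_def inner_bound_def outer_bound_def)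
qed

section \<open>The poset of initial sections\<close>

lemma carrier_IS_poset: "carrier (IS_poset (G, \<theta>)) = {A. feasible A}"
  by (auto simp: IS_poset_def IS_iff_feasible)

lemma le_IS_poset: "A \<sqsubseteq>\<^bsub>IS_poset (G, \<theta>)\<^esub> B \<longleftrightarrow> A \<subseteq> B"
  by (simp add: IS_poset_def)

lemma less_IS_poset: "A \<sqsubset>\<^bsub>IS_poset (G, \<theta>)\<^esub> B \<longleftrightarrow> A \<subset> B"
  by (auto simp: IS_poset_def lless_def)

lemma partial_order_IS_poset: "partial_order (IS_poset (G, \<theta>))"
  by unfold_locales (simp_all add: IS_poset_def)

lemma complete_meet_semilattice_IS_poset: "complete_meet_semilattice (IS_poset (G, \<theta>))"
proof -
  interpret partial_order "IS_poset (G, \<theta>)"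
    by (rule partial_order_IS_poset)
  show ?thesis
  proof
    fix \<A> assume \<A>: "\<A> \<subseteq> carrier (IS_poset (G, \<theta>))" "\<A> \<noteq> {}"
    then have "feasible (\<Union>{C. feasible C \<and> C \<subseteq> \<Inter>\<A>})"
      by (intro feasible_Union_lower) (auto simp: carrier_IS_poset)
    then have "greatest (IS_poset (G, \<theta>)) (\<Union>{C. feasible C \<and> C \<subseteq> \<Inter>\<A>})
        (Lower (IS_poset (G, \<theta>)) \<A>)"
      using \<A>(1) by (auto simp: greatest_def Lower_def carrier_IS_poset le_IS_poset)
    then show "\<exists>i. greatest (IS_poset (G, \<theta>)) i (Lower (IS_poset (G, \<theta>)) \<A>)" ..
  qed
qed

lemma graded_poset_IS_poset: "graded_poset (IS_poset (G, \<theta>)) card"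
proof -
  interpret partial_order "IS_poset (G, \<theta>)"
    by (rule partial_order_IS_poset)
  show ?thesis
  proof
    fix A assume "A \<in> carrier (IS_poset (G, \<theta>))"
      "\<nexists>B. B \<in> carrier (IS_poset (G, \<theta>)) \<and> B \<sqsubset>\<^bsub>IS_poset (G, \<theta>)\<^esub> A"
    then have "A = {}"
      using feasible_empty by (auto simp: carrier_IS_poset less_IS_poset)
    then show "card A = 0" by simp
  next
    fix A B assume "B \<in> carrier (IS_poset (G, \<theta>))" "A \<sqsubset>\<^bsub>IS_poset (G, \<theta>)\<^esub> B"
    then show "card A < card B"
      by (auto simp: carrier_IS_poset less_IS_poset feasible_def intro: psubset_card_mono)
  next
    fix A B assume "covered_by (IS_poset (G, \<theta>)) A B"
    then have AB: "feasible A" "feasible B" "A \<subset> B"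
      and no: "\<And>C. feasible C \<Longrightarrow> A \<subset> C \<Longrightarrow> \<not> C \<subset> B"
      by (auto simp: covered_by_def carrier_IS_poset less_IS_poset)
    obtain x where x: "x \<in> B - A" "feasible (insert x A)"
      using feasible_extend AB by blast
    \<comment> \<open>Otherwise \<open>insert x A\<close> would lie strictly between
      \<open>A\<close> and \<open>B\<close>.\<close>
    then have "B = insert x A"
      using no[of "insert x A"] AB(3) by blast
    then show "card B = Suc (card A)"
      using x AB(1) by (simp add: feasible_def)
  qed
qed

text \<open>A greatest element together with infima of nonempty families suffices; here the full
  vertex set is greatest.\<close>

lemma complete_lattice_IS_poset:
  assumes "finite (pverts G)"
  shows "complete_lattice (IS_poset (G, \<theta>))"
proof -
  interpret complete_meet_semilattice "IS_poset (G, \<theta>)"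
    by (rule complete_meet_semilattice_IS_poset)
  have "greatest (IS_poset (G, \<theta>)) (pverts G) (carrier (IS_poset (G, \<theta>)))"
    using feasible_pverts[OF assms]
    by (auto simp: greatest_def carrier_IS_poset le_IS_poset feasible_def)
  then show ?thesis
    using inf_exists by (intro complete_lattice_criterion1) blast+
qed

end

theorem theorem1:
  fixes G :: "'a pair_pre_digraph" and \<theta> :: "'a \<Rightarrow> nat"
  assumes "valued_digraph G \<theta>"
  shows "complete_meet_semilattice (IS_poset (G, \<theta>)) \<and>
         graded_poset (IS_poset (G, \<theta>)) card \<and>
         (finite (pverts G) \<longrightarrow> complete_lattice (IS_poset (G, \<theta>)))"
  using valued_digraph.complete_meet_semilattice_IS_poset[OF assms]
    valued_digraph.graded_poset_IS_poset[OF assms]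
    valued_digraph.complete_lattice_IS_poset[OF assms]
  by blast

end
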